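(* Let $n\geq 2$, $p>0$, and let $f\in C_0(\mathbb{Z}^n)$ be nonnegative with $\|f\|_p=1$. Then $$\left(\frac1n+\frac1p-1\right)\sum_{z\in\mathbb{Z}^n}f(z)^p\log f(z)^p\leq-\log 2+\frac1n\sum_{i=1}^n\log\|\partial_i f\|_1.$$ Moreover, equality holds if and only if $f=|A|^{-\frac1p}\cdot\chi_A$ for some cuboid $A$ in $\mathbb{Z}^n$.
   Context: $C_0(\mathbb{Z}^n)$ denotes the space of real-valued functions on $\mathbb{Z}^n$ with finite support. For $q>0$ and $f\in C_0(\mathbb{Z}^n)$, $\|f\|_q:=\left(\sum_{z\in\mathbb{Z}^n}|f(z)|^q\right)^{1/q}$. For $i=1,\dots,n$, $\partial_i f(z):=f(z+e_i)-f(z)$ for $z\in\mathbb{Z}^n$, where $e_i\in\mathbb{Z}^n$ is the vector whose $i$-th component is $1$ and whose other components are $0$. The convention $0\log 0=0$ is used. $\chi_A$ is the indicator function of $A$ and $|A|$ its cardinality. A cuboid in $\mathbb{Z}^n$ is a set of the form $A=\prod_{i=1}^n[a_i,b_i]$ with $a_i,b_i\in\mathbb{Z}$, $a_i\leq b_i$, where $[a,b]=\{z\in\mathbb{Z} : a\leq z\leq b\}$. *)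

theory Defs
  imports "HOL-Analysis.Analysis"
begin

text \<open>The lattice of integer vectors of dimension \<open>n\<close> is the type \<open>int ^ 'n\<close>, with
  \<open>n = CARD('n)\<close>; the standard basis vector in direction \<open>i\<close> is \<open>axis i 1\<close>.\<close>

definition C0 :: "(int ^ 'n \<Rightarrow> real) set" where
  "C0 = {f. finite {z. f z \<noteq> 0}}"

text \<open>For \<open>f \<in> C0\<close> and \<open>q > 0\<close> only finitely many summands are nonzero, since \<open>0 powr q = 0\<close>,
  so the unordered infinite sum is an ordinary finite sum.\<close>

definition lnorm :: "real \<Rightarrow> (int ^ 'n \<Rightarrow> real) \<Rightarrow> real" where
  "lnorm q f = (\<Sum>\<^sub>\<infinity>z. \<bar>f z\<bar> powr q) powr (1 / q)"

definition pdiff :: "'n \<Rightarrow> (int ^ 'n \<Rightarrow> real) \<Rightarrow> (int ^ 'n \<Rightarrow> real)" where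
  "pdiff i f = (\<lambda>z. f (z + axis i 1) - f z)"

definition cuboid :: "(int ^ 'n) set \<Rightarrow> bool" where
  "cuboid A \<longleftrightarrow> (\<exists>a b. (\<forall>i. a $ i \<le> b $ i) \<and> A = {z. \<forall>i. z $ i \<in> {a $ i..b $ i}})"

end

theory Submission
  imports Defs
begin

text \<open>The function \<open>\<mu> = f\<^sup>p\<close> is a probability mass function, and \<open>f z\<close> is at most half the total
  variation \<open>2 * G\<^sub>i z\<close> of \<open>f\<close> along the line through \<open>z\<close> in direction \<open>i\<close>. Multiplied by \<open>n\<close>, the
  left-hand side equals \<open>(n - 1) * H(\<mu>) + n * (\<Sum>z. \<mu> z * ln (f z))\<close>. Han's inequality bounds the
  first term by the sum over \<open>i\<close> of the entropies of the marginals of \<open>\<mu>\<close> that forget coordinate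
  \<open>i\<close>, and \<open>f \<le> G\<^sub>i\<close> bounds the second; Gibbs' inequality for each such marginal against \<open>G\<^sub>i\<close>,
  regarded as a function on the lines in direction \<open>i\<close>, finishes the proof. Equality makes the
  mutual informations in Han's inequality vanish, so the support of \<open>f\<close> is closed under exchanging
  coordinates, and forces \<open>f = G\<^sub>i\<close> on the support, so \<open>f\<close> is constant there and the support meets
  every coordinate line in an interval.\<close>

section \<open>Replacing one coordinate and comparing vectors on a set of coordinates\<close>

definition upd :: "'a ^ 'n \<Rightarrow> 'n \<Rightarrow> 'a \<Rightarrow> 'a ^ 'n" where
  "upd z i t = (\<chi> j. if j = i then t else z $ j)"

lemma upd_nth [simp]: "upd z i t $ j = (if j = i then t else z $ j)"
  by (simp add: upd_def)

lemma upd_same [simp]: "upd z i (z $ i) = z"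
  by (simp add: vec_eq_iff)

definition agree :: "'n set \<Rightarrow> 'a ^ 'n \<Rightarrow> 'a ^ 'n \<Rightarrow> bool" where
  "agree A z w \<longleftrightarrow> (\<forall>j\<in>A. z $ j = w $ j)"

lemma agree_UNIV [simp]: "agree UNIV z w \<longleftrightarrow> z = w"
  by (auto simp: agree_def vec_eq_iff)

lemma agree_empty [simp]: "agree {} z w"
  by (simp add: agree_def)

lemma agree_refl [simp]: "agree A z z"
  by (simp add: agree_def)

lemma agree_sym: "agree A z w \<longleftrightarrow> agree A w z"
  by (auto simp: agree_def)

lemma agree_trans: "agree A u w \<Longrightarrow> agree A w z \<Longrightarrow> agree A u z"
  by (simp add: agree_def)

lemma agree_upd: "agree (- {i}) z (upd z i t)"
  by (simp add: agree_def)

lemma agree_glue: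
  assumes "i \<notin> A"
  shows "agree (insert i A) w z \<and> agree (- {i}) u z \<longleftrightarrow> z = upd u i (w $ i) \<and> agree A u w"
proof
  assume *: "agree (insert i A) w z \<and> agree (- {i}) u z"
  then have "z = upd u i (w $ i)"
    by (simp add: agree_def vec_eq_iff)
  moreover have "u $ j = w $ j" if "j \<in> A" for j
    using * that assms unfolding agree_def by (metis ComplI insertCI singletonD)
  ultimately show "z = upd u i (w $ i) \<and> agree A u w"
    by (simp add: agree_def)
next
  assume "z = upd u i (w $ i) \<and> agree A u w"
  then show "agree (insert i A) w z \<and> agree (- {i}) u z"
    by (simp add: agree_def)
qed

section \<open>Entropies of the marginals of a finite law\<close>

locale finite_law =
  fixes S :: "('a ^ 'n) set" and \<mu> :: "'a ^ 'n \<Rightarrow> real"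
  assumes finite_S: "finite S"
    and mu_pos: "z \<in> S \<Longrightarrow> 0 < \<mu> z"
    and mu_sum: "sum \<mu> S = 1"
begin

text \<open>The marginal on the coordinates in \<open>A\<close> is kept as a function of the whole
  vector, constant on the classes of \<open>agree A\<close>. Marginals for all \<open>A\<close> thus
  share one type, and averaging \<open>- ln (marg A z)\<close> against \<open>\<mu>\<close> gives
  the Shannon entropy without any projection.\<close>

definition marg :: "'n set \<Rightarrow> 'a ^ 'n \<Rightarrow> real" where
  "marg A z = (\<Sum>w\<in>S. if agree A w z then \<mu> w else 0)"

definition ent :: "'n set \<Rightarrow> real" where
  "ent A = - (\<Sum>z\<in>S. \<mu> z * ln (marg A z))"

text \<open>The conditional mutual information of coordinate \<open>i\<close> and the coordinates outside
  \<open>insert i A\<close>, given those in \<open>A\<close>.\<close>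

definition info :: "'n set \<Rightarrow> 'n \<Rightarrow> real" where
  "info A i = ent (insert i A) + ent (- {i}) - ent A - ent UNIV"

lemma marg_pos: "z \<in> S \<Longrightarrow> 0 < marg A z"
  unfolding marg_def
  by (rule sum_pos2[OF finite_S, of z]) (auto simp: mu_pos less_imp_le)

lemma marg_UNIV: "z \<in> S \<Longrightarrow> marg UNIV z = \<mu> z"
  by (simp add: marg_def finite_S)

lemma marg_empty: "marg {} z = 1"
  by (simp add: marg_def mu_sum)

lemma marg_cong: "agree A w z \<Longrightarrow> marg A w = marg A z"
  unfolding marg_def
  by (intro sum.cong refl if_cong) (meson agree_sym agree_trans)

lemma ent_empty: "ent {} = 0"
  by (simp add: ent_def marg_empty)

text \<open>The summand is the law making coordinate \<open>i\<close> independent of the coordinates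
  outside \<open>insert i A\<close>, given those in \<open>A\<close>. To sample it, draw a pair
  \<open>w\<close>, \<open>u\<close> agreeing on \<open>A\<close> with weight
  \<open>\<mu> w * \<mu> u / marg A w\<close> and glue them to \<open>upd u i (w $ i)\<close>. By
  \<open>agree_glue\<close> each pair meets at most one \<open>z\<close>.\<close>

lemma coupling_sum:
  assumes "i \<notin> A"
  shows "(\<Sum>z\<in>S. marg (insert i A) z * marg (- {i}) z / marg A z)
    = (\<Sum>w\<in>S. \<Sum>u\<in>S. if agree A u w \<and> upd u i (w $ i) \<in> S then \<mu> w * \<mu> u / marg A w else 0)"
proof -
  have "(\<Sum>z\<in>S. marg (insert i A) z * marg (- {i}) z / marg A z)
      = (\<Sum>z\<in>S. \<Sum>w\<in>S. \<Sum>u\<in>S. if agree (insert i A) w z \<and> agree (- {i}) u z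
            then \<mu> w * \<mu> u / marg A w else 0)"
  proof (intro sum.cong refl)
    fix z
    have eq: "marg A w = marg A z" if "agree (insert i A) w z" for w
      using that by (intro marg_cong) (simp add: agree_def)
    show "marg (insert i A) z * marg (- {i}) z / marg A z
        = (\<Sum>w\<in>S. \<Sum>u\<in>S. if agree (insert i A) w z \<and> agree (- {i}) u z
            then \<mu> w * \<mu> u / marg A w else 0)"
      unfolding marg_def[of "insert i A"] marg_def[of "- {i}"] sum_product sum_divide_distrib
      by (intro sum.cong refl) (auto dest: eq)
  qed
  also have "\<dots> = (\<Sum>w\<in>S. \<Sum>z\<in>S. \<Sum>u\<in>S. if agree (insert i A) w z \<and> agree (- {i}) u z
            then \<mu> w * \<mu> u / marg A w else 0)"
    by (rule sum.swap)
  also have "\<dots> = (\<Sum>w\<in>S. \<Sum>u\<in>S. \<Sum>z\<in>S. if agree (insert i A) w z \<and> agree (- {i}) u z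
            then \<mu> w * \<mu> u / marg A w else 0)"
    by (intro sum.cong refl sum.swap)
  also have "\<dots> = (\<Sum>w\<in>S. \<Sum>u\<in>S. \<Sum>z\<in>S. if z = upd u i (w $ i)
            then (if agree A u w then \<mu> w * \<mu> u / marg A w else 0) else 0)"
    unfolding agree_glue[OF assms] by (intro sum.cong refl) auto
  also have "\<dots> = (\<Sum>w\<in>S. \<Sum>u\<in>S. if agree A u w \<and> upd u i (w $ i) \<in> S
            then \<mu> w * \<mu> u / marg A w else 0)"
    by (intro sum.cong refl) (auto simp: finite_S)
  finally show ?thesis .
qed

lemma agree_pairs_sum:
  "(\<Sum>w\<in>S. \<Sum>u\<in>S. if agree A u w then \<mu> w * \<mu> u / marg A w else 0) = 1"
proof -
  have "(\<Sum>u\<in>S. if agree A u w then \<mu> w * \<mu> u / marg A w else 0) = \<mu> w" if "w \<in> S" for w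
  proof -
    have "(\<Sum>u\<in>S. if agree A u w then \<mu> w * \<mu> u / marg A w else 0)
        = \<mu> w / marg A w * marg A w"
      unfolding marg_def[of A w] sum_distrib_left by (intro sum.cong refl) auto
    then show ?thesis
      using marg_pos[OF that, of A] by simp
  qed
  then show ?thesis
    by (simp add: mu_sum)
qed

text \<open>\<open>info A i\<close> is the relative entropy of \<open>\<mu>\<close> with respect to
  the law in \<open>coupling_sum\<close>. Since that law has total mass 1,
  \<open>ln x \<le> x - 1\<close> bounds the entropy below by the mass lying outside
  \<open>S\<close>. The equality case needs this mass, not just the bound 0.\<close>

lemma info_ge:
  assumes "i \<notin> A"
  shows "(\<Sum>w\<in>S. \<Sum>u\<in>S. if agree A u w \<and> upd u i (w $ i) \<notin> S
            then \<mu> w * \<mu> u / marg A w else 0) \<le> info A i"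
proof -
  let ?r = "\<lambda>z. marg (insert i A) z * marg (- {i}) z / marg A z"
  have "(\<Sum>w\<in>S. \<Sum>u\<in>S. if agree A u w \<and> upd u i (w $ i) \<notin> S
            then \<mu> w * \<mu> u / marg A w else 0)
      = (\<Sum>w\<in>S. \<Sum>u\<in>S. (if agree A u w then \<mu> w * \<mu> u / marg A w else 0)
          - (if agree A u w \<and> upd u i (w $ i) \<in> S then \<mu> w * \<mu> u / marg A w else 0))"
    by (intro sum.cong refl) auto
  also have "\<dots> = 1 - (\<Sum>z\<in>S. ?r z)"
    by (simp add: sum_subtractf coupling_sum[OF assms] agree_pairs_sum)
  also have "\<dots> = (\<Sum>z\<in>S. \<mu> z - ?r z)"
    by (simp add: sum_subtractf mu_sum)
  also have "\<dots> \<le> (\<Sum>z\<in>S. \<mu> z * (ln (marg A z) + ln (marg UNIV z)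
      - ln (marg (insert i A) z) - ln (marg (- {i}) z)))"
  proof (rule sum_mono)
    fix z assume z: "z \<in> S"
    note pos = mu_pos[OF z] marg_pos[OF z]
    have "ln (?r z / \<mu> z) \<le> ?r z / \<mu> z - 1"
      by (rule ln_le_minus_one) (simp add: pos)
    then have "\<mu> z * (1 - ?r z / \<mu> z) \<le> \<mu> z * (- ln (?r z / \<mu> z))"
      using pos(1) by (intro mult_left_mono) auto
    moreover have "\<mu> z * (1 - ?r z / \<mu> z) = \<mu> z - ?r z"
      using pos(1) by (simp add: right_diff_distrib)
    moreover have "ln (?r z / \<mu> z) = ln (marg (insert i A) z) + ln (marg (- {i}) z)
        - ln (marg A z) - ln (\<mu> z)"
      using pos(1) pos(2)[THEN order_less_imp_not_eq2] by (simp add: ln_mult ln_div)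
    ultimately have "\<mu> z - ?r z \<le> \<mu> z * - (ln (marg (insert i A) z) + ln (marg (- {i}) z)
        - ln (marg A z) - ln (\<mu> z))"
      by (simp only:)
    then show "\<mu> z - ?r z \<le> \<mu> z * (ln (marg A z) + ln (marg UNIV z)
      - ln (marg (insert i A) z) - ln (marg (- {i}) z))"
      by (simp add: marg_UNIV[OF z] algebra_simps)
  qed
  also have "\<dots> = info A i"
    by (simp add: info_def ent_def algebra_simps sum.distrib sum_subtractf sum_negf)
  finally show ?thesis .
qed

lemma info_nonneg:
  assumes "i \<notin> A"
  shows "0 \<le> info A i"
proof -
  have "0 \<le> (\<Sum>w\<in>S. \<Sum>u\<in>S. if agree A u w \<and> upd u i (w $ i) \<notin> S
            then \<mu> w * \<mu> u / marg A w else 0)"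
    by (intro sum_nonneg) (auto intro!: divide_nonneg_pos mult_nonneg_nonneg marg_pos
        simp: mu_pos less_imp_le)
  also have "\<dots> \<le> info A i"
    by (rule info_ge[OF assms])
  finally show ?thesis .
qed

text \<open>For \<open>A = {}\<close> each pair whose glued point leaves \<open>S\<close> would add
  \<open>\<mu> w * \<mu> u > 0\<close> to the lower bound of \<open>info_ge\<close>.\<close>

lemma info_zero_closed:
  assumes "info {} i = 0" "u \<in> S" "w \<in> S"
  shows "upd u i (w $ i) \<in> S"
proof (rule ccontr)
  assume no: "upd u i (w $ i) \<notin> S"
  let ?g = "\<lambda>w u. if upd u i (w $ i) \<notin> S then \<mu> w * \<mu> u else 0"
  have nn: "0 \<le> ?g w' u'" if "w' \<in> S" "u' \<in> S" for w' u'
    using that mu_pos by (auto simp: less_imp_le)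
  have "0 < (\<Sum>w\<in>S. \<Sum>u\<in>S. ?g w u)"
  proof (rule sum_pos2[OF finite_S \<open>w \<in> S\<close>])
    show "0 < (\<Sum>u\<in>S. ?g w u)"
      by (rule sum_pos2[OF finite_S \<open>u \<in> S\<close>]) (use no assms mu_pos nn in auto)
  qed (intro sum_nonneg nn)
  also have "\<dots> \<le> 0"
    using info_ge[of i "{}", unfolded marg_empty div_by_1] assms(1) by simp
  finally show False by simp
qed

text \<open>Han's inequality with a remainder: by the chain rule the entropy of the coordinates in
  \<open>B\<close> exceeds the sum of the conditional entropies given all other coordinates.\<close>

lemma han_remainder:
  assumes "finite B" "i \<notin> B"
  shows "info {} i + (\<Sum>j\<in>insert i B. ent UNIV - ent (- {j})) \<le> ent (insert i B)"
  using assms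
proof (induction B)
  case empty
  then show ?case by (simp add: info_def ent_empty)
next
  case (insert k B)
  then have "0 \<le> info (insert i B) k"
    by (intro info_nonneg) auto
  then show ?case
    using insert by (simp add: info_def insert_commute)
qed

text \<open>Any \<open>i\<close> may come first in the chain rule, so the remainder
  \<open>info {} i\<close> is available for every \<open>i\<close>.\<close>

lemma han:
  "info {} i + (real CARD('n) - 1) * ent UNIV \<le> (\<Sum>j\<in>UNIV. ent (- {j}))"
proof -
  have "info {} i + (\<Sum>j\<in>insert i (- {i}). ent UNIV - ent (- {j})) \<le> ent (insert i (- {i}))"
    by (rule han_remainder) auto
  moreover have "insert i (- {i}) = UNIV" by auto
  ultimately show ?thesis
    by (simp add: sum_subtractf algebra_simps)
qed

text \<open>\<open>L z\<close> is the mass that \<open>\<phi>\<close> gives to the class of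
  \<open>z\<close> under \<open>agree A\<close>. This is Gibbs' inequality for the marginal on
  \<open>A\<close> against \<open>L\<close> normalized by \<open>sum \<phi> D\<close>; classes that
  miss \<open>S\<close> only add slack.\<close>

lemma gibbs_lines:
  fixes \<phi> :: "'a ^ 'n \<Rightarrow> real" and A :: "'n set" and D :: "('a ^ 'n) set"
  defines "L \<equiv> \<lambda>z. \<Sum>w\<in>D. if agree A z w then \<phi> w else 0"
  assumes D: "finite D" and nn: "\<And>w. 0 \<le> \<phi> w" and L: "\<And>z. z \<in> S \<Longrightarrow> 0 < L z"
  shows "ent A + (\<Sum>z\<in>S. \<mu> z * ln (L z)) \<le> ln (sum \<phi> D)"
proof -
  let ?T = "sum \<phi> D"
  obtain z0 where z0: "z0 \<in> S"
    using mu_sum by fastforce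
  have "L z0 \<le> ?T"
    unfolding L_def by (intro sum_mono) (auto simp: nn)
  then have T: "0 < ?T"
    using L[OF z0] by simp
  have inner: "(\<Sum>z\<in>S. if agree A z w then \<mu> z / marg A z else 0) \<le> 1" for w
  proof -
    have "(\<Sum>z\<in>S. if agree A z w then \<mu> z / marg A z else 0)
        = (\<Sum>z\<in>S. if agree A z w then \<mu> z else 0) / marg A w"
      unfolding sum_divide_distrib by (intro sum.cong refl) (auto dest: marg_cong)
    \<comment> \<open>The quotient is 1 if the class of \<open>w\<close> meets \<open>S\<close>;
      otherwise it is \<open>0 / 0 = 0\<close>.\<close>
    also have "\<dots> \<le> 1"
      by (simp add: marg_def)
    finally show ?thesis .
  qed
  have "(\<Sum>z\<in>S. \<mu> z * L z / marg A z)
      = (\<Sum>z\<in>S. \<Sum>w\<in>D. \<phi> w * (if agree A z w then \<mu> z / marg A z else 0))"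
    unfolding L_def sum_distrib_left sum_divide_distrib by (intro sum.cong refl) auto
  also have "\<dots> = (\<Sum>w\<in>D. \<Sum>z\<in>S. \<phi> w * (if agree A z w then \<mu> z / marg A z else 0))"
    by (rule sum.swap)
  also have "\<dots> = (\<Sum>w\<in>D. \<phi> w * (\<Sum>z\<in>S. if agree A z w then \<mu> z / marg A z else 0))"
    by (simp add: sum_distrib_left)
  also have "\<dots> \<le> (\<Sum>w\<in>D. \<phi> w * 1)"
    by (intro sum_mono mult_left_mono inner nn)
  finally have le: "(\<Sum>z\<in>S. \<mu> z * L z / marg A z) \<le> ?T"
    by simp
  have "(\<Sum>z\<in>S. \<mu> z * (ln (L z) - ln (marg A z) - ln ?T))
      \<le> (\<Sum>z\<in>S. \<mu> z * L z / marg A z / ?T - \<mu> z)"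
  proof (rule sum_mono)
    fix z assume z: "z \<in> S"
    note pos = mu_pos[OF z] marg_pos[OF z, of A] L[OF z] T
    have "ln (L z / (marg A z * ?T)) \<le> L z / (marg A z * ?T) - 1"
      by (rule ln_le_minus_one) (simp add: pos)
    then have "\<mu> z * ln (L z / (marg A z * ?T)) \<le> \<mu> z * (L z / (marg A z * ?T) - 1)"
      using pos(1) by (intro mult_left_mono) auto
    then show "\<mu> z * (ln (L z) - ln (marg A z) - ln ?T)
        \<le> \<mu> z * L z / marg A z / ?T - \<mu> z"
      using pos by (simp add: ln_mult ln_div algebra_simps)
  qed
  also have "\<dots> = (\<Sum>z\<in>S. \<mu> z * L z / marg A z) / ?T - 1"
    by (simp add: sum_subtractf sum_divide_distrib mu_sum)
  also have "\<dots> \<le> 0"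
    using le T by simp
  finally show ?thesis
    by (simp add: ent_def right_diff_distrib sum_subtractf mu_sum flip: sum_distrib_right)
qed

end

section \<open>Variation along coordinate lines and norms of differences\<close>

lemma abs_diff_le_variation:
  fixes g :: "int \<Rightarrow> real"
  assumes "a \<le> b"
  shows "\<bar>g b - g a\<bar> \<le> (\<Sum>t\<in>{a..<b}. \<bar>g (t + 1) - g t\<bar>)"
  using assms
proof (induction b rule: int_ge_induct)
  case (step b)
  have "{a..<b + 1} = insert b {a..<b}"
    using step by auto
  then show ?case
    using step by simp
qed simp

text \<open>For \<open>s = r = t\<close> this bounds twice the maximum by the total variation; for \<open>r\<close> strictly
  in between it shows that a function attaining this bound at \<open>s\<close> and \<open>t\<close> has no gap there.\<close>

lemma variation_ge:
  fixes g :: "int \<Rightarrow> real"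
  assumes "a \<le> s" "s \<le> r" "r \<le> t" "t \<le> b" "g a = 0" "g b = 0"
  shows "2 * (g s + g t - g r) \<le> (\<Sum>t\<in>{a..<b}. \<bar>g (t + 1) - g t\<bar>)"
proof -
  define V where "V x y = (\<Sum>t\<in>{x..<y}. \<bar>g (t + 1) - g t\<bar>)" for x y
  have split: "V x z = V x y + V y z" if "x \<le> y" "y \<le> z" for x y z
  proof -
    have "{x..<z} = {x..<y} \<union> {y..<z}" using that by auto
    then show ?thesis by (simp add: V_def sum.union_disjoint)
  qed
  \<comment> \<open>The four legs lead from 0 to \<open>g s\<close>, to \<open>g r\<close>, to
    \<open>g t\<close> and back to 0; each costs at least its difference of heights.\<close>
  have "V a b = V a s + V s r + V r t + V t b"
    using assms split[of a s b] split[of s r b] split[of r t b] by simp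
  moreover have "g y - g x \<le> V x y" "g x - g y \<le> V x y" if "x \<le> y" for x y
    using abs_diff_le_variation[OF that, of g] unfolding V_def abs_le_iff by simp_all
  then have "g s - g a \<le> V a s" "g s - g r \<le> V s r" "g t - g r \<le> V r t" "g t - g b \<le> V t b"
    using assms by blast+
  ultimately have "2 * (g s + g t - g r) \<le> V a b"
    using assms(5,6) by simp
  then show ?thesis
    by (simp add: V_def)
qed

lemma finite_int_avoid:
  fixes X :: "int set"
  assumes "finite X"
  obtains a b where "a \<le> s" "t \<le> b" "a \<notin> X" "b \<notin> X"
proof -
  have "infinite ({..s} - X)" "infinite ({t..} - X)"
    using assms infinite_Iic infinite_Ici by (auto simp: Diff_infinite_finite)
  then show thesis
    using that by (metis Diff_iff atLeast_iff atMost_iff finite.emptyI ex_in_conv)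
qed

lemma pdiff_upd:
  fixes f :: "int ^ 'n \<Rightarrow> real"
  shows "pdiff i f (upd z i t) = f (upd z i (t + 1)) - f (upd z i t)"
proof -
  have "upd z i t + axis i 1 = upd z i (t + 1)"
    by (simp add: vec_eq_iff axis_def)
  then show ?thesis
    by (simp add: pdiff_def)
qed

lemma finite_pdiff:
  fixes f :: "int ^ 'n \<Rightarrow> real"
  assumes "finite {z. f z \<noteq> 0}"
  shows "finite {z. pdiff i f z \<noteq> 0}"
proof (rule finite_subset)
  show "{z. pdiff i f z \<noteq> 0} \<subseteq> {z. f z \<noteq> 0} \<union> (\<lambda>z. z - axis i 1) ` {z. f z \<noteq> 0}"
    by (auto simp: pdiff_def image_iff) (metis add_diff_cancel_right')
qed (use assms in auto)

text \<open>Half the total variation of \<open>f\<close> on the line through \<open>z\<close> in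
  direction \<open>i\<close>, written in the form of \<open>L\<close> in \<open>gibbs_lines\<close>.
  The half makes it an upper bound for \<open>f\<close>.\<close>

definition lines :: "'n \<Rightarrow> (int ^ 'n \<Rightarrow> real) \<Rightarrow> int ^ 'n \<Rightarrow> real" where
  "lines i f z = (\<Sum>w\<in>{w. pdiff i f w \<noteq> 0}. if agree (- {i}) z w then \<bar>pdiff i f w\<bar> / 2 else 0)"

lemma lines_upd: "lines i f (upd z i t) = lines i f z"
  unfolding lines_def by (intro sum.cong refl if_cong) (auto simp: agree_def)

lemma lines_ge:
  fixes f :: "int ^ 'n \<Rightarrow> real"
  assumes fin: "finite {z. f z \<noteq> 0}" and "s \<le> r" "r \<le> t"
  shows "f (upd z i s) + f (upd z i t) - f (upd z i r) \<le> lines i f z"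
proof -
  have inj: "inj_on (upd z i) X" for X
    by (rule inj_onI) (metis upd_nth)
  have "finite {t. f (upd z i t) \<noteq> 0}"
    using finite_vimageI[OF fin inj] by (simp add: vimage_def)
  \<comment> \<open>The line meets the support in a finite set, so endpoints where \<open>f\<close>
    vanishes exist on both sides.\<close>
  then obtain a b where ab: "a \<le> s" "t \<le> b" "f (upd z i a) = 0" "f (upd z i b) = 0"
    using finite_int_avoid[of "{t. f (upd z i t) \<noteq> 0}" s t] by auto
  let ?D = "{w. pdiff i f w \<noteq> 0}"
  have "2 * (f (upd z i s) + f (upd z i t) - f (upd z i r))
      \<le> (\<Sum>t\<in>{a..<b}. \<bar>f (upd z i (t + 1)) - f (upd z i t)\<bar>)"
    using variation_ge[of a s r t b "\<lambda>t. f (upd z i t)"] ab assms by simp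
  also have "\<dots> = (\<Sum>w\<in>upd z i ` {a..<b}. \<bar>pdiff i f w\<bar>)"
    by (simp add: sum.reindex[OF inj] pdiff_upd)
  also have "\<dots> = (\<Sum>w\<in>upd z i ` {a..<b} \<inter> ?D. \<bar>pdiff i f w\<bar>)"
    by (rule sum.mono_neutral_right) auto
  also have "\<dots> = (\<Sum>w\<in>upd z i ` {a..<b} \<inter> ?D. if agree (- {i}) z w then \<bar>pdiff i f w\<bar> else 0)"
    by (rule sum.cong) (auto simp: agree_upd)
  also have "\<dots> \<le> (\<Sum>w\<in>?D. if agree (- {i}) z w then \<bar>pdiff i f w\<bar> else 0)"
    by (rule sum_mono2[OF finite_pdiff[OF fin]]) auto
  also have "\<dots> = 2 * lines i f z"
    unfolding lines_def sum_distrib_left by (intro sum.cong refl) auto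
  finally show ?thesis by simp
qed

lemma le_lines:
  fixes f :: "int ^ 'n \<Rightarrow> real"
  assumes "finite {z. f z \<noteq> 0}"
  shows "f z \<le> lines i f z"
  using lines_ge[OF assms, of "z $ i" "z $ i" "z $ i" z i] by simp

lemma infsum_support:
  fixes g :: "'a \<Rightarrow> real"
  assumes "finite S" "\<And>z. z \<notin> S \<Longrightarrow> g z = 0"
  shows "(\<Sum>\<^sub>\<infinity>z. g z) = sum g S"
proof -
  have "(\<Sum>\<^sub>\<infinity>z. g z) = infsum g S"
    by (rule infsum_cong_neutral) (use assms in auto)
  then show ?thesis
    using assms by simp
qed

lemma lnorm_1_pdiff:
  fixes f :: "int ^ 'n \<Rightarrow> real"
  assumes "finite {z. f z \<noteq> 0}"
  shows "lnorm 1 (pdiff i f) = (\<Sum>w\<in>{w. pdiff i f w \<noteq> 0}. \<bar>pdiff i f w\<bar>)"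
  unfolding lnorm_def
  using infsum_support[OF finite_pdiff[OF assms], of i "\<lambda>z. \<bar>pdiff i f z\<bar> powr 1"]
  by (simp add: sum_nonneg)

section \<open>From the equality conditions to a cuboid\<close>

lemma box_induct:
  fixes z0 z :: "'a ^ 'n"
  assumes "P z0" and step: "\<And>y i. P y \<Longrightarrow> P (upd y i (z $ i))"
  shows "P z"
proof -
  have "P (\<chi> j. if j \<in> A then z $ j else z0 $ j)" for A
    using finite[of A]
  proof (induction A)
    case empty
    then show ?case using assms(1) by simp
  next
    case (insert k A)
    have "(\<chi> j. if j \<in> insert k A then z $ j else z0 $ j)
        = upd (\<chi> j. if j \<in> A then z $ j else z0 $ j) k (z $ k)"
      by (auto simp: vec_eq_iff)
    then show ?case
      using step[OF insert.IH] by simp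
  qed
  from this[of UNIV] show ?thesis by simp
qed

text \<open>\<open>S\<close> fills its bounding box: starting in \<open>S\<close>, the coordinates
  are changed one at a time to those of any point of the box, without leaving \<open>S\<close> or
  changing the value of \<open>f\<close>.\<close>

lemma extremal_is_cuboid:
  fixes f :: "int ^ 'n \<Rightarrow> real"
  defines "S \<equiv> {z. f z \<noteq> 0}"
  assumes fin: "finite S" and ne: "S \<noteq> {}" and nn: "\<And>z. 0 \<le> f z"
    and closed: "\<And>u w i. u \<in> S \<Longrightarrow> w \<in> S \<Longrightarrow> upd u i (w $ i) \<in> S"
    and eq: "\<And>z i. z \<in> S \<Longrightarrow> f z = lines i f z"
  obtains c where "cuboid S" "c > 0" "\<And>z. z \<in> S \<Longrightarrow> f z = c"
proof -
  obtain z0 where z0: "z0 \<in> S" using ne by auto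
  define a b where "a = (\<chi> i. Min ((\<lambda>z. z $ i) ` S))" and "b = (\<chi> i. Max ((\<lambda>z. z $ i) ` S))"
  have bounds: "a $ i \<le> z $ i \<and> z $ i \<le> b $ i" if "z \<in> S" for z i
    using that fin by (simp add: a_def b_def)
  have main: "z \<in> S \<and> f z = f z0" if z: "\<And>i. z $ i \<in> {a $ i..b $ i}" for z
  proof (rule box_induct[where P = "\<lambda>z. z \<in> S \<and> f z = f z0"])
    show "z0 \<in> S \<and> f z0 = f z0" using z0 by simp
  next
    fix y i assume y: "y \<in> S \<and> f y = f z0"
    have "a $ i \<in> (\<lambda>z. z $ i) ` S" "b $ i \<in> (\<lambda>z. z $ i) ` S"
      using fin ne by (simp_all add: a_def b_def)
    then obtain u v where uv: "u \<in> S" "a $ i = u $ i" "v \<in> S" "b $ i = v $ i"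
      by auto
    \<comment> \<open>The extreme coordinates are attained in \<open>S\<close>, so both points lie
      in \<open>S\<close> by closedness. They are on the line of \<open>y\<close>, where
      \<open>lines\<close> is constant.\<close>
    have ends: "f (upd y i (a $ i)) = f y" "f (upd y i (b $ i)) = f y"
      using closed[of y u i] closed[of y v i] uv y eq[of _ i] by (auto simp: lines_upd)
    \<comment> \<open>Both end values already equal \<open>lines i f y\<close>, so \<open>f\<close>
      cannot drop below that value in between.\<close>
    have "f (upd y i (a $ i)) + f (upd y i (b $ i)) - f (upd y i (z $ i)) \<le> lines i f y"
      using z[of i] by (intro lines_ge) (use fin S_def in auto)
    then have "f y \<le> f (upd y i (z $ i))"
      using ends eq[of y i] y by simp
    moreover have "0 < f y"
      using y nn[of y] by (simp add: S_def less_le)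
    ultimately have "upd y i (z $ i) \<in> S"
      by (simp add: S_def)
    then show "upd y i (z $ i) \<in> S \<and> f (upd y i (z $ i)) = f z0"
      using y eq[of "upd y i (z $ i)" i] eq[of y i] by (simp add: lines_upd)
  qed
  have "S = {z. \<forall>i. z $ i \<in> {a $ i..b $ i}}"
  proof (intro set_eqI iffI)
    fix z assume "z \<in> {z. \<forall>i. z $ i \<in> {a $ i..b $ i}}"
    then show "z \<in> S" using main[of z] by blast
  qed (use bounds in auto)
  moreover have "a $ i \<le> b $ i" for i
    using bounds[OF z0, of i] by simp
  ultimately have "cuboid S"
    unfolding cuboid_def by blast
  moreover have "f z = f z0" if "z \<in> S" for z
    using main[of z] bounds[OF that] by simp
  moreover have "f z0 > 0"
    using z0 nn[of z0] by (simp add: S_def less_le)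
  ultimately show thesis
    using that by blast
qed

section \<open>Cuboids attain equality\<close>

lemma card_vec_box:
  fixes B :: "'n::finite \<Rightarrow> 'a set"
  shows "card {z :: 'a ^ 'n. \<forall>i. z $ i \<in> B i} = (\<Prod>i\<in>UNIV. card (B i))"
proof -
  have "bij_betw vec_lambda (Pi\<^sub>E UNIV B) {z :: 'a ^ 'n. \<forall>i. z $ i \<in> B i}"
    by (rule bij_betwI[where g = vec_nth]) (auto simp: PiE_def)
  then have "card (Pi\<^sub>E UNIV B) = card {z :: 'a ^ 'n. \<forall>i. z $ i \<in> B i}"
    by (rule bij_betw_same_card)
  then show ?thesis
    by (simp add: card_PiE)
qed

lemma finite_vec_box:
  fixes B :: "'n::finite \<Rightarrow> 'a set"
  assumes "\<And>i. finite (B i)"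
  shows "finite {z :: 'a ^ 'n. \<forall>i. z $ i \<in> B i}"
proof -
  have "{z :: 'a ^ 'n. \<forall>i. z $ i \<in> B i} = vec_lambda ` Pi\<^sub>E UNIV B"
    by (auto intro!: image_eqI[of _ vec_lambda "vec_nth _"])
  then show ?thesis
    using assms by (simp add: finite_PiE)
qed

lemma cuboid_lnorm_1_pdiff:
  fixes a b :: "int ^ 'n" and c :: real
  assumes ab: "\<And>i. a $ i \<le> b $ i" and A: "A = {z. \<forall>i. z $ i \<in> {a $ i..b $ i}}" and "c > 0"
  shows "lnorm 1 (pdiff i (\<lambda>z. c * indicator A z))
    = 2 * c * real (card A) / real_of_int (b $ i - a $ i + 1)"
proof -
  \<comment> \<open>A forward difference jumps one step before the lower face, at
    \<open>a $ i - 1\<close>, and on the upper face, at \<open>b $ i\<close>. These differ even for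
    side length 1, so the box always has two layers.\<close>
  define B where "B j = (if j = i then {a $ i - 1, b $ i} else {a $ j..b $ j})" for j
  let ?D = "{z :: int ^ 'n. \<forall>j. z $ j \<in> B j}"
  have abs_eq: "\<bar>pdiff i (\<lambda>z. c * indicator A z) z\<bar> = c * indicator ?D z" for z
  proof -
    have 1: "z + axis i 1 \<in> A \<longleftrightarrow> (\<forall>j. j \<noteq> i \<longrightarrow> z $ j \<in> {a $ j..b $ j}) \<and> z $ i \<in> {a $ i - 1..b $ i - 1}"
      unfolding A by (auto simp: axis_def)
    have 2: "z \<in> A \<longleftrightarrow> (\<forall>j. j \<noteq> i \<longrightarrow> z $ j \<in> {a $ j..b $ j}) \<and> z $ i \<in> {a $ i..b $ i}"
      unfolding A by auto
    have 3: "z \<in> ?D \<longleftrightarrow> (\<forall>j. j \<noteq> i \<longrightarrow> z $ j \<in> {a $ j..b $ j}) \<and> z $ i \<in> {a $ i - 1, b $ i}"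
      unfolding B_def by auto
    show ?thesis
      unfolding pdiff_def indicator_def 1 2 3 using \<open>c > 0\<close> ab[of i] by auto
  qed
  have finD: "finite ?D"
    by (rule finite_vec_box) (simp add: B_def)
  have "lnorm 1 (pdiff i (\<lambda>z. c * indicator A z)) = (\<Sum>\<^sub>\<infinity>z. c * indicator ?D z)"
    using \<open>c > 0\<close> by (simp add: lnorm_def abs_eq infsum_nonneg)
  also have "\<dots> = (\<Sum>z\<in>?D. c * indicator ?D z)"
    by (rule infsum_support[OF finD]) simp
  also have "\<dots> = c * real (card ?D)"
    by simp
  also have "card ?D = 2 * (\<Prod>j\<in>UNIV - {i}. card {a $ j..b $ j})"
  proof -
    have "card ?D = card (B i) * (\<Prod>j\<in>UNIV - {i}. card (B j))"
      unfolding card_vec_box by (rule prod.remove) auto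
    moreover have "card (B i) = 2"
      using ab[of i] by (simp add: B_def)
    ultimately show ?thesis by (simp add: B_def)
  qed
  also have "c * real (2 * (\<Prod>j\<in>UNIV - {i}. card {a $ j..b $ j}))
      = 2 * c * real (card A) / real_of_int (b $ i - a $ i + 1)"
  proof -
    have "card A = card {a $ i..b $ i} * (\<Prod>j\<in>UNIV - {i}. card {a $ j..b $ j})"
      unfolding A card_vec_box[of "\<lambda>j. {a $ j..b $ j}"] by (rule prod.remove) auto
    then show ?thesis
      using ab[of i] by simp
  qed
  finally show ?thesis .
qed

text \<open>The side lengths multiply to \<open>card A\<close>, so both sides reduce to
  \<open>(1 - 1 / p - 1 / n) * ln (card A)\<close>, where \<open>n = CARD('n)\<close>.\<close>

lemma cuboid_equality:
  fixes A :: "(int ^ 'n) set"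
  assumes "cuboid A" and p: "p > 0" and f: "f = (\<lambda>z. real (card A) powr (- 1 / p) * indicator A z)"
  shows "(1 / real CARD('n) + 1 / p - 1) * (\<Sum>\<^sub>\<infinity>z. f z powr p * ln (f z powr p))
    = - ln 2 + 1 / real CARD('n) * (\<Sum>i\<in>UNIV. ln (lnorm 1 (pdiff i f)))"
proof -
  obtain a b where ab: "\<And>i. a $ i \<le> b $ i" and A: "A = {z. \<forall>i. z $ i \<in> {a $ i..b $ i}}"
    using assms(1) unfolding cuboid_def by auto
  define N where "N = real (card A)"
  have finA: "finite A"
    unfolding A by (rule finite_vec_box) auto
  have "A \<noteq> {}"
    using ab by (auto simp: A intro!: exI[of _ a])
  then have N: "N > 0"
    using finA by (simp add: N_def card_gt_0_iff)
  have len: "0 < real_of_int (b $ i - a $ i + 1)" for i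
    using ab[of i] by linarith
  have "N = (\<Prod>i\<in>UNIV. real_of_int (b $ i - a $ i + 1))"
    unfolding N_def A card_vec_box[of "\<lambda>j. {a $ j..b $ j}"] of_nat_prod
    by (intro prod.cong refl) (use ab in \<open>simp add: le_add_diff\<close>)
  then have lnN: "ln N = (\<Sum>i\<in>UNIV. ln (real_of_int (b $ i - a $ i + 1)))"
    by (simp only:) (rule ln_prod[OF finite less_imp_neq[OF len, symmetric]])
  have "(\<Sum>\<^sub>\<infinity>z. f z powr p * ln (f z powr p)) = (\<Sum>z\<in>A. f z powr p * ln (f z powr p))"
    by (rule infsum_support[OF finA]) (simp add: f)
  also have "\<dots> = (\<Sum>z\<in>A. - ln N / N)"
  proof (intro sum.cong refl)
    fix z assume "z \<in> A"
    then have "f z powr p = 1 / N"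
      using p N by (simp add: f powr_powr powr_divide powr_minus_divide flip: N_def)
    then show "f z powr p * ln (f z powr p) = - ln N / N"
      using N by (simp add: ln_div)
  qed
  also have "\<dots> = - ln N"
    using N by (simp add: N_def)
  finally have L: "(\<Sum>\<^sub>\<infinity>z. f z powr p * ln (f z powr p)) = - ln N" .
  have "ln (lnorm 1 (pdiff i f)) = ln 2 + (1 - 1 / p) * ln N - ln (real_of_int (b $ i - a $ i + 1))" for i
  proof -
    have "lnorm 1 (pdiff i f) = 2 * N powr (- 1 / p) * N / real_of_int (b $ i - a $ i + 1)"
      unfolding f using cuboid_lnorm_1_pdiff[OF ab A, of "N powr (- 1 / p)" i] N
      by (simp add: N_def)
    then show ?thesis
      using N len[of i] by (simp add: ln_mult ln_div ln_powr algebra_simps)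
  qed
  then have "(\<Sum>i\<in>UNIV. ln (lnorm 1 (pdiff i f)))
      = real CARD('n) * (ln 2 + (1 - 1 / p) * ln N) - ln N"
    by (simp add: sum.distrib sum_subtractf lnN)
  then show ?thesis
    unfolding L by (simp add: field_simps)
qed

section \<open>The inequality with remainders and its equality case\<close>

theorem corollary1p2:
  fixes p :: real and f :: "int ^ 'n \<Rightarrow> real"
  assumes "CARD('n) \<ge> 2"
    and "p > 0"
    and "f \<in> C0"
    and "\<And>z. f z \<ge> 0"
    and "lnorm p f = 1"
  shows "(1 / real CARD('n) + 1 / p - 1) * (\<Sum>\<^sub>\<infinity>z. f z powr p * ln (f z powr p))
           \<le> - ln 2 + 1 / real CARD('n) * (\<Sum>i\<in>UNIV. ln (lnorm 1 (pdiff i f)))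
         \<and> ((1 / real CARD('n) + 1 / p - 1) * (\<Sum>\<^sub>\<infinity>z. f z powr p * ln (f z powr p))
               = - ln 2 + 1 / real CARD('n) * (\<Sum>i\<in>UNIV. ln (lnorm 1 (pdiff i f)))
             \<longleftrightarrow> (\<exists>A. cuboid A \<and> f = (\<lambda>z. real (card A) powr (- 1 / p) * indicator A z)))"
    (is "?lhs \<le> ?rhs \<and> _")
proof -
  define S where "S = {z. f z \<noteq> 0}"
  define \<mu> where "\<mu> z = f z powr p" for z
  let ?n = "real CARD('n)"
  have finS: "finite S"
    using assms(3) by (simp add: C0_def S_def)
  note fin = finS[unfolded S_def]
  have f_pos: "0 < f z" if "z \<in> S" for z
    using that assms(4)[of z] by (simp add: S_def less_le)
  have "(\<Sum>\<^sub>\<infinity>z. \<bar>f z\<bar> powr p) = sum \<mu> S"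
    using infsum_support[OF finS, of "\<lambda>z. \<bar>f z\<bar> powr p"] assms(4) by (simp add: S_def \<mu>_def)
  then have "sum \<mu> S powr (1 / p) = 1"
    using assms(5) by (simp add: lnorm_def)
  then have "(sum \<mu> S powr (1 / p)) powr p = 1"
    by simp
  then have mu1: "sum \<mu> S = 1"
    using assms(2) by (simp add: powr_powr sum_nonneg \<mu>_def)
  interpret finite_law S \<mu>
    by unfold_locales (use finS f_pos mu1 in \<open>auto simp: \<mu>_def S_def\<close>)
  define E where "E = (\<Sum>\<^sub>\<infinity>z. f z powr p * ln (f z powr p))"
  have E_sum: "E = (\<Sum>z\<in>S. \<mu> z * ln (\<mu> z))"
    unfolding E_def \<mu>_def by (rule infsum_support[OF finS]) (simp add: S_def)
  then have E_ent: "E = - ent UNIV"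
    by (simp add: ent_def marg_UNIV)
  have E_f: "(\<Sum>z\<in>S. \<mu> z * ln (f z)) = E / p"
    unfolding E_sum sum_divide_distrib
    by (intro sum.cong refl) (use f_pos assms(2) in \<open>simp add: \<mu>_def ln_powr less_imp_neq[symmetric]\<close>)
  have lines_pos: "0 < lines i f z" if "z \<in> S" for z i
    using f_pos[OF that] le_lines[OF fin, of z i] by simp
  define T where "T i = lnorm 1 (pdiff i f)" for i
  obtain z0 where z0: "z0 \<in> S"
    using mu1 by fastforce
  have T_half: "(\<Sum>w\<in>{w. pdiff i f w \<noteq> 0}. \<bar>pdiff i f w\<bar> / 2) = T i / 2" for i
    by (simp add: T_def lnorm_1_pdiff[OF fin] sum_divide_distrib)
  have T_pos: "0 < T i" for i
  proof -
    have "lines i f z0 \<le> T i / 2"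
      unfolding lines_def T_half[symmetric] by (intro sum_mono) auto
    then show ?thesis using lines_pos[OF z0, of i] by simp
  qed
  have gibbs: "ent (- {i}) + (\<Sum>z\<in>S. \<mu> z * ln (lines i f z)) \<le> ln (T i / 2)" for i
    using gibbs_lines[OF finite_pdiff[OF fin, of i], of "\<lambda>w. \<bar>pdiff i f w\<bar> / 2" "- {i}"]
      lines_pos[of _ i] by (simp add: lines_def T_half)
  \<comment> \<open>The loss from replacing \<open>lines i f\<close> by \<open>f\<close>, kept as a
    second remainder for the equality case.\<close>
  define \<delta> where "\<delta> = (\<Sum>i\<in>UNIV. \<Sum>z\<in>S. \<mu> z * (ln (lines i f z) - ln (f z)))"
  have gap: "0 \<le> \<mu> z * (ln (lines i f z) - ln (f z))" if "z \<in> S" for z i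
    using that le_lines[OF fin, of z i] f_pos lines_pos mu_pos
    by (intro mult_nonneg_nonneg) (auto simp: less_imp_le)
  have \<delta>_nonneg: "0 \<le> \<delta>"
    unfolding \<delta>_def by (intro sum_nonneg gap)
  have bound: "?n * ?lhs + info {} i + \<delta> \<le> ?n * ?rhs" for i
  proof -
    have "(\<Sum>i\<in>UNIV. ent (- {i}) + (\<Sum>z\<in>S. \<mu> z * ln (lines i f z))) \<le> (\<Sum>i\<in>UNIV. ln (T i / 2))"
      by (intro sum_mono gibbs)
    \<comment> \<open>The halves in \<open>lines\<close> are the source of
      \<open>- ln 2\<close>.\<close>
    also have "\<dots> = (\<Sum>i\<in>UNIV. ln (T i)) - ?n * ln 2"
      using T_pos[THEN order_less_imp_not_eq2] by (simp add: ln_div sum_subtractf)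
    also have "\<dots> = ?n * ?rhs"
      by (simp add: T_def algebra_simps)
    finally have "(\<Sum>i\<in>UNIV. ent (- {i})) + (\<Sum>i\<in>UNIV. \<Sum>z\<in>S. \<mu> z * ln (lines i f z)) \<le> ?n * ?rhs"
      by (simp add: sum.distrib)
    moreover have "(\<Sum>i\<in>UNIV. \<Sum>z\<in>S. \<mu> z * ln (lines i f z)) = \<delta> + ?n * (E / p)"
      by (simp add: \<delta>_def right_diff_distrib sum_subtractf E_f)
    moreover have "?n * ?lhs = (?n - 1) * ent UNIV + ?n * (E / p)"
      unfolding E_def[symmetric] E_ent by (simp add: field_simps)
    ultimately show ?thesis
      using han[of i] by linarith
  qed
  have info: "0 \<le> info {} i" for i
    by (rule info_nonneg) simp
  have n: "0 < ?n" by simp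
  have ineq: "?lhs \<le> ?rhs"
  proof -
    have "?n * ?lhs \<le> ?n * ?rhs"
      \<comment> \<open>Any direction serves here; \<open>undefined\<close> merely names
        one.\<close>
      using bound[of undefined] info[of undefined] \<delta>_nonneg by linarith
    then show ?thesis
      using n mult_le_cancel_left_pos by blast
  qed
  have "\<exists>A. cuboid A \<and> f = (\<lambda>z. real (card A) powr (- 1 / p) * indicator A z)" if "?lhs = ?rhs"
  proof -
    \<comment> \<open>Equality leaves no room for either nonnegative remainder in
      \<open>bound\<close>.\<close>
    have "info {} i = 0" "\<delta> = 0" for i
      using bound[of i] info[of i] \<delta>_nonneg that by simp_all
    then have closed: "upd u i (w $ i) \<in> S" if "u \<in> S" "w \<in> S" for u w i
      using that by (intro info_zero_closed)
    have eq: "f z = lines i f z" if "z \<in> S" for z i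
    proof -
      have "(\<Sum>z\<in>S. \<mu> z * (ln (lines i f z) - ln (f z))) = 0"
        using \<open>\<delta> = 0\<close> unfolding \<delta>_def
        by (subst (asm) sum_nonneg_eq_0_iff) (auto intro!: sum_nonneg gap)
      then have "\<mu> z * (ln (lines i f z) - ln (f z)) = 0"
        using that by (subst (asm) sum_nonneg_eq_0_iff[OF finS]) (auto intro!: gap)
      then show ?thesis
        using mu_pos[OF that] f_pos[OF that] lines_pos[OF that, of i] by simp
    qed
    obtain c where c: "cuboid S" "c > 0" "\<And>z. z \<in> S \<Longrightarrow> f z = c"
      using extremal_is_cuboid[of f] fin z0 closed eq assms(4) unfolding S_def by blast
    \<comment> \<open>The normalization of \<open>f\<close> determines the constant
      \<open>c\<close>.\<close>
    have "real (card S) * c powr p = 1"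
      using mu1 c(3) by (simp add: \<mu>_def)
    then have "c powr p = 1 / real (card S)"
      using z0 finS by (auto simp: eq_divide_eq mult.commute)
    then have "(c powr p) powr (1 / p) = (1 / real (card S)) powr (1 / p)"
      by simp
    then have "c = real (card S) powr (- 1 / p)"
      using c(2) assms(2) by (simp add: powr_powr powr_divide powr_minus_divide)
    then have "f z = real (card S) powr (- 1 / p) * indicator S z" for z
      by (cases "z \<in> S") (simp_all add: c(3), simp add: S_def)
    with c(1) show ?thesis by (auto simp: fun_eq_iff)
  qed
  moreover have "?lhs = ?rhs"
    if "\<exists>A. cuboid A \<and> f = (\<lambda>z. real (card A) powr (- 1 / p) * indicator A z)"
    using that cuboid_equality[OF _ assms(2)] by blast
  ultimately show ?thesis
    using ineq by blast
qed

end
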